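(* Fix a real number $\epsilon$ with $0<\epsilon<1$ and integers $m\geq 2$ and $D\geq 3$. Then, up to isomorphism, there are only finitely many distance-regular graphs with smallest eigenvalue at least $-m$, diameter $D$, and intersection numbers $a_1,c_2$ satisfying $c_2\geq \epsilon a_1$.
   Context: A finite connected graph $\Gamma$ with diameter $D$ is distance-regular if there are integers $b_i,c_i$ ($0\le i\le D$) such that for any vertices $x,y$ with $d(x,y)=i$, exactly $c_i$ neighbours of $y$ are at distance $i-1$ from $x$ and exactly $b_i$ neighbours of $y$ are at distance $i+1$ from $x$; its valency is $k=b_0$ and $a_i:=k-b_i-c_i$. The smallest eigenvalue is that of the adjacency matrix. *)

theory Defs
  imports Complex_Main
begin

definition simple_graph :: "'a set \<Rightarrow> ('a \<Rightarrow> 'a \<Rightarrow> bool) \<Rightarrow> bool" where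
  "simple_graph V E \<longleftrightarrow> finite V \<and> V \<noteq> {} \<and>
     (\<forall>x y. E x y \<longrightarrow> x \<in> V \<and> y \<in> V) \<and>
     (\<forall>x y. E x y \<longrightarrow> E y x) \<and> (\<forall>x. \<not> E x x)"

fun walk :: "('a \<Rightarrow> 'a \<Rightarrow> bool) \<Rightarrow> nat \<Rightarrow> 'a \<Rightarrow> 'a \<Rightarrow> bool" where
  "walk E 0 x y = (x = y)"
| "walk E (Suc n) x y = (\<exists>z. E x z \<and> walk E n z y)"

definition connected_graph :: "'a set \<Rightarrow> ('a \<Rightarrow> 'a \<Rightarrow> bool) \<Rightarrow> bool" where
  "connected_graph V E \<longleftrightarrow> (\<forall>x\<in>V. \<forall>y\<in>V. \<exists>n. walk E n x y)"

text \<open>Path-length distance (meaningful for vertices in a connected graph).\<close>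
definition gdist :: "('a \<Rightarrow> 'a \<Rightarrow> bool) \<Rightarrow> 'a \<Rightarrow> 'a \<Rightarrow> nat" where
  "gdist E x y = (LEAST n. walk E n x y)"

definition diameter :: "'a set \<Rightarrow> ('a \<Rightarrow> 'a \<Rightarrow> bool) \<Rightarrow> nat" where
  "diameter V E = Max {gdist E x y | x y. x \<in> V \<and> y \<in> V}"

text \<open>Distance-regular graph with diameter D and intersection numbers b_i, c_i
(0 \<le> i \<le> D). For i = 0 the set counted by c_0 is empty anyway.\<close>
definition distance_regular ::
  "'a set \<Rightarrow> ('a \<Rightarrow> 'a \<Rightarrow> bool) \<Rightarrow> nat \<Rightarrow> (nat \<Rightarrow> nat) \<Rightarrow> (nat \<Rightarrow> nat) \<Rightarrow> bool" where
  "distance_regular V E D b c \<longleftrightarrow>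
     simple_graph V E \<and> connected_graph V E \<and> diameter V E = D \<and>
     (\<forall>i\<le>D. \<forall>x\<in>V. \<forall>y\<in>V. gdist E x y = i \<longrightarrow>
        card {z\<in>V. E y z \<and> i \<ge> 1 \<and> gdist E x z = i - 1} = c i \<and>
        card {z\<in>V. E y z \<and> gdist E x z = i + 1} = b i)"

text \<open>Real eigenvalues of the adjacency matrix (which is real symmetric, so all
its eigenvalues are real and have real eigenvectors): A f = \<mu> f, f \<noteq> 0.\<close>
definition adj_eigenvalue :: "'a set \<Rightarrow> ('a \<Rightarrow> 'a \<Rightarrow> bool) \<Rightarrow> real \<Rightarrow> bool" where
  "adj_eigenvalue V E \<mu> \<longleftrightarrow>
     (\<exists>f::'a \<Rightarrow> real. (\<exists>x\<in>V. f x \<noteq> 0) \<and>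
        (\<forall>x\<in>V. (\<Sum>y\<in>{y\<in>V. E x y}. f y) = \<mu> * f x))"

definition graph_iso ::
  "'a set \<Rightarrow> ('a \<Rightarrow> 'a \<Rightarrow> bool) \<Rightarrow> 'b set \<Rightarrow> ('b \<Rightarrow> 'b \<Rightarrow> bool) \<Rightarrow> bool" where
  "graph_iso V E W F \<longleftrightarrow>
     (\<exists>h. bij_betw h V W \<and> (\<forall>x\<in>V. \<forall>y\<in>V. E x y \<longleftrightarrow> F (h x) (h y)))"

end

theory Submission
  imports Defs "HOL-Analysis.Function_Topology" "HOL-Library.Ramsey"
begin

text \<open>Let \<open>k = b 0\<close> be the valency. The matrix \<open>A + m I\<close> is positive semidefinite, so an
independent set of neighbours of a vertex has at most \<open>m\<^sup>2\<close> elements and \<open>k \<le> m\<^sup>2 (a\<^sub>1 + 1)\<close>;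
together with \<open>c\<^sub>2 \<ge> \<epsilon> a\<^sub>1\<close> this makes \<open>c\<^sub>2\<close>
at least a fixed fraction of \<open>k\<close> once \<open>k\<close> is large, and then \<open>|V| \<le> C k\<close>. As \<open>D \<ge> 3\<close>,
also \<open>k \<le> 3 (b\<^sub>1 + 1)\<close>, so the neighbourhoods of two adjacent vertices differ in a positive
proportion of the vertices. On the other hand, by positivity every vertex is adjacent to
boundedly many or to all but boundedly many vertices of a clique, so it separates few pairs of
neighbourhoods of clique vertices. Counting bounds the size of the cliques, and Ramsey's theorem
inside a neighbourhood then bounds \<open>k\<close>.\<close>

subsection \<open>The Rayleigh quotient\<close>

text \<open>First-order condition at a minimum: were p nonzero, a small step against its sign would
  make the quadratic negative. Here t will be a perturbation of one coordinate of the
  minimiser.\<close>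

lemma linear_coeff_zero_of_nonneg:
  fixes p q :: real
  assumes "\<And>t. 0 \<le> 2 * t * p + t\<^sup>2 * q"
  shows "p = 0"
proof (rule ccontr)
  assume p: "p \<noteq> 0"
  \<comment> \<open>Q exceeds both 0 and q, so t = -p/Q yields (p/Q)^2 (q - 2Q) < 0.\<close>
  define Q where "Q = \<bar>q\<bar> + 1"
  have Q: "Q > 0" "q < Q" unfolding Q_def by auto
  have "0 \<le> 2 * (- p / Q) * p + (- p / Q)\<^sup>2 * q" by (rule assms)
  also have "\<dots> = (p\<^sup>2 / Q\<^sup>2) * (q - 2 * Q)"
    using Q by (simp add: field_simps power2_eq_square)
  also have "\<dots> < 0"
    using p Q by (intro mult_pos_neg) auto
  finally show False by simp
qed

text \<open>A minimiser of the Rayleigh quotient on the (compact) unit sphere is an eigenvector.\<close>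

lemma quadratic_form_ge_least_eigenvalue:
  fixes a :: "'a \<Rightarrow> 'a \<Rightarrow> real"
  assumes fin: "finite V"
    and sym: "\<And>x y. x \<in> V \<Longrightarrow> y \<in> V \<Longrightarrow> a x y = a y x"
    and eig: "\<And>\<mu> f. \<lbrakk>\<exists>x\<in>V. f x \<noteq> 0; \<forall>x\<in>V. (\<Sum>y\<in>V. a x y * f y) = \<mu> * f x\<rbrakk> \<Longrightarrow> l \<le> \<mu>"
  shows "l * (\<Sum>x\<in>V. (f x)\<^sup>2) \<le> (\<Sum>x\<in>V. f x * (\<Sum>y\<in>V. a x y * f y))"
proof -
  define N :: "('a \<Rightarrow> real) \<Rightarrow> real" where "N f = (\<Sum>x\<in>V. (f x)\<^sup>2)" for f
  define q :: "('a \<Rightarrow> real) \<Rightarrow> real" where "q f = (\<Sum>x\<in>V. f x * (\<Sum>y\<in>V. a x y * f y))" for f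
  \<comment> \<open>Unit vectors have entries in [-1,1]; pinning the coordinates outside V to 0
    makes this box compact in the product topology on all functions, by Tychonoff.\<close>
  define B :: "('a \<Rightarrow> real) set" where "B = PiE UNIV (\<lambda>x. if x \<in> V then {-1..1} else {0})"
  define K where "K = B \<inter> {f. N f = 1}"
  have N0: "N f = 0 \<longleftrightarrow> (\<forall>x\<in>V. f x = 0)" for f
    unfolding N_def using fin by (simp add: sum_nonneg_eq_0_iff)
  have Nnn: "N f \<ge> 0" for f unfolding N_def by (simp add: sum_nonneg)
  show ?thesis
  proof (cases "N f = 0")
    case True
    then show ?thesis using N0[of f] by simp
  next
    case False
    have "compactin (product_topology (\<lambda>_. euclidean) UNIV) B"
      unfolding B_def compactin_PiE by auto
    then have cB: "compact B" by (simp add: euclidean_product_topology)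
    have cN: "continuous_on UNIV N"
      unfolding N_def by (intro continuous_intros) auto
    have cq: "continuous_on UNIV q"
      unfolding q_def by (intro continuous_intros) auto
    have cl: "closed {f. N f = 1}"
      using continuous_closed_preimage[OF cN closed_UNIV closed_singleton[of 1]]
      by (simp add: vimage_def)
    have cK: "compact K" unfolding K_def using cB cl by (rule compact_Int_closed)
    define nm where "nm f x = (if x \<in> V then f x / sqrt (N f) else 0)" for f and x :: 'a
    have nmN: "N (nm f) = 1" if "N f \<noteq> 0" for f
    proof -
      have "N (nm f) = (\<Sum>x\<in>V. (f x)\<^sup>2 / N f)"
        unfolding N_def nm_def using Nnn[of f]
        by (intro sum.cong) (auto simp: power_divide N_def)
      also have "\<dots> = N f / N f"
        unfolding sum_divide_distrib[symmetric] by (simp add: N_def)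
      finally show ?thesis using that by simp
    qed
    have nmK: "nm f \<in> K" if "N f \<noteq> 0" for f
    proof -
      have "\<bar>nm f x\<bar> \<le> 1" if x: "x \<in> V" for x
      proof -
        have "(nm f x)\<^sup>2 \<le> N (nm f)" unfolding N_def by (rule member_le_sum[OF x]) (use fin in auto)
        then show ?thesis using nmN[OF \<open>N f \<noteq> 0\<close>] by (simp add: abs_square_le_1)
      qed
      then have "nm f x \<in> (if x \<in> V then {-1..1} else {0})" for x
        by (cases "x \<in> V") (simp add: abs_le_iff minus_le_iff, simp add: nm_def)
      then have "nm f \<in> B" unfolding B_def by (intro PiE_I) auto
      then show ?thesis unfolding K_def using nmN that by simp
    qed
    have nmq: "q (nm f) * N f = q f" if "N f \<noteq> 0" for f
    proof -
      have "q (nm f) = (\<Sum>x\<in>V. (f x * (\<Sum>y\<in>V. a x y * f y)) / N f)"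
        unfolding q_def
      proof (rule sum.cong)
        fix x assume x: "x \<in> V"
        have "(\<Sum>y\<in>V. a x y * nm f y) = (\<Sum>y\<in>V. a x y * f y) / sqrt (N f)"
          by (simp add: nm_def sum_divide_distrib)
        then have "nm f x * (\<Sum>y\<in>V. a x y * nm f y)
            = (f x * (\<Sum>y\<in>V. a x y * f y)) / (sqrt (N f) * sqrt (N f))"
          using x by (simp add: nm_def)
        then show "nm f x * (\<Sum>y\<in>V. a x y * nm f y) = (f x * (\<Sum>y\<in>V. a x y * f y)) / N f"
          using Nnn[of f] by simp
      qed simp
      also have "\<dots> = q f / N f"
        unfolding sum_divide_distrib[symmetric] by (simp add: q_def)
      finally show ?thesis using that by simp
    qed
    have "K \<noteq> {}" using nmK[OF False] by auto
    then obtain g where g: "g \<in> K" and gmin: "\<And>h. h \<in> K \<Longrightarrow> q g \<le> q h"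
      using continuous_attains_inf[OF cK _ continuous_on_subset[OF cq]] by blast
    \<comment> \<open>Both sides are homogeneous of degree 2, so minimality on the sphere extends to
      every f by normalising.\<close>
    have ray: "q g * N f \<le> q f" for f
    proof (cases "N f = 0")
      case True
      then have "q f = 0" unfolding q_def using N0 by simp
      then show ?thesis using True by simp
    next
      case False
      have "q g * N f \<le> q (nm f) * N f"
        using gmin[OF nmK[OF False]] Nnn by (rule mult_right_mono)
      then show ?thesis using nmq[OF False] by simp
    qed
    have Ng: "N g = 1" using g K_def by simp
    have "(\<Sum>y\<in>V. a x y * g y) = q g * g x" if x: "x \<in> V" for x
    proof -
      define A where "A u = (\<Sum>y\<in>V. a u y * g y)" for u
      \<comment> \<open>Move the minimiser by t in the single coordinate x. By \<open>ray\<close> a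
        quadratic in t is then nonnegative, and the vanishing of its linear coefficient is the
        eigenvector equation at x.\<close>
      have qexp: "q (\<lambda>u. g u + (if u = x then t else 0)) = q g + 2 * t * A x + t\<^sup>2 * a x x" for t
      proof -
        have in1: "(\<Sum>y\<in>V. a u y * (g y + (if y = x then t else 0))) = A u + a u x * t" for u
          using x fin by (simp add: A_def distrib_left sum.distrib if_distrib[of "(*) _"] cong: if_cong)
        have "(\<Sum>u\<in>V. g u * a u x) = A x"
          unfolding A_def using sym x by (intro sum.cong) auto
        moreover have "(\<Sum>u\<in>V. g u * (a u x * t)) = (\<Sum>u\<in>V. g u * a u x) * t"
          by (simp add: sum_distrib_right mult.assoc)
        ultimately have s: "(\<Sum>u\<in>V. g u * (a u x * t)) = A x * t" by simp
        have "q (\<lambda>u. g u + (if u = x then t else 0))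
            = (\<Sum>u\<in>V. g u * A u + g u * (a u x * t) + (if u = x then t * (A u + a u x * t) else 0))"
          unfolding q_def in1 by (intro sum.cong) (auto simp: algebra_simps)
        also have "\<dots> = q g + A x * t + t * (A x + a x x * t)"
          using x fin s by (simp add: sum.distrib q_def A_def)
        finally show ?thesis by (simp add: algebra_simps power2_eq_square)
      qed
      have Nexp: "N (\<lambda>u. g u + (if u = x then t else 0)) = 1 + 2 * t * g x + t\<^sup>2" for t
      proof -
        have "N (\<lambda>u. g u + (if u = x then t else 0))
            = (\<Sum>u\<in>V. (g u)\<^sup>2 + (if u = x then 2 * t * g u + t\<^sup>2 else 0))"
          unfolding N_def by (intro sum.cong) (auto simp: algebra_simps power2_eq_square)
        also have "\<dots> = N g + (2 * t * g x + t\<^sup>2)"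
          using x fin by (simp add: sum.distrib N_def)
        finally show ?thesis using Ng by simp
      qed
      have "A x - q g * g x = 0"
      proof (rule linear_coeff_zero_of_nonneg)
        fix t
        show "0 \<le> 2 * t * (A x - q g * g x) + t\<^sup>2 * (a x x - q g)"
          using ray[of "\<lambda>u. g u + (if u = x then t else 0)"] unfolding qexp Nexp
          by (simp add: algebra_simps)
      qed
      then show ?thesis by (simp add: A_def)
    qed
    moreover have "\<exists>x\<in>V. g x \<noteq> 0" using N0[of g] Ng by auto
    ultimately have "l \<le> q g" using eig[of g "q g"] by auto
    then have "l * N f \<le> q g * N f" using Nnn by (rule mult_right_mono)
    also have "\<dots> \<le> q f" by (rule ray)
    finally show ?thesis unfolding N_def q_def .
  qed
qed

subsection \<open>Distances and intersection numbers\<close>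

definition nbrs :: "('a \<Rightarrow> 'a \<Rightarrow> bool) \<Rightarrow> 'a \<Rightarrow> 'a set" where
  "nbrs E x = {y. E x y}"

lemma walk_trans: "walk E m x y \<Longrightarrow> walk E n y z \<Longrightarrow> walk E (m + n) x z"
  by (induction m arbitrary: x) auto

lemma gdist_le: "walk E n x y \<Longrightarrow> gdist E x y \<le> n"
  unfolding gdist_def by (rule Least_le)

section \<open>Walk distance and distance layers in connected graphs\<close>

locale simple_connected =
  fixes V :: "'a set" and E :: "'a \<Rightarrow> 'a \<Rightarrow> bool"
  assumes simple: "simple_graph V E" and connected: "connected_graph V E"
begin

lemma finV: "finite V" and V_nonempty: "V \<noteq> {}"
  and edgeD1: "E x y \<Longrightarrow> x \<in> V" and edgeD2: "E x y \<Longrightarrow> y \<in> V"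
  and edge_sym: "E x y \<Longrightarrow> E y x" and edge_irrefl: "\<not> E x x"
  using simple unfolding simple_graph_def by blast+

lemma edge_commute: "E x y \<longleftrightarrow> E y x"
  using edge_sym by blast

lemma in_nbrs [simp]: "y \<in> nbrs E x \<longleftrightarrow> E x y"
  by (simp add: nbrs_def)

lemma nbrs_subset: "nbrs E x \<subseteq> V"
  using edgeD2 by auto

lemma finite_nbrs [simp]: "finite (nbrs E x)"
  using finite_subset[OF nbrs_subset finV] .

lemma walk_sym: "walk E n x y \<Longrightarrow> walk E n y x"
proof (induction n arbitrary: x)
  case (Suc n)
  then obtain z where "E x z" "walk E n y z" by auto
  moreover have "walk E 1 z x" using \<open>E x z\<close> edge_sym by simp
  ultimately show ?case using walk_trans[of E n y z 1 x] by simp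
qed simp

lemma walk_gdist: "x \<in> V \<Longrightarrow> y \<in> V \<Longrightarrow> walk E (gdist E x y) x y"
  unfolding gdist_def using connected unfolding connected_graph_def by (metis LeastI_ex)

lemma gdist_triangle:
  assumes "x \<in> V" "y \<in> V" "z \<in> V"
  shows "gdist E x z \<le> gdist E x y + gdist E y z"
  by (rule gdist_le[OF walk_trans[OF walk_gdist[OF assms(1,2)] walk_gdist[OF assms(2,3)]]])

lemma gdist_commute: "x \<in> V \<Longrightarrow> y \<in> V \<Longrightarrow> gdist E x y = gdist E y x"
  using gdist_le[OF walk_sym[OF walk_gdist]] by (meson antisym)

lemma gdist_self [simp]: "gdist E x x = 0"
  using gdist_le[of E 0 x x] by simp

lemma gdist_eq_0_iff: "x \<in> V \<Longrightarrow> y \<in> V \<Longrightarrow> gdist E x y = 0 \<longleftrightarrow> x = y"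
  using walk_gdist[of x y] by auto

lemma gdist_eq_1_iff: "x \<in> V \<Longrightarrow> y \<in> V \<Longrightarrow> gdist E x y = 1 \<longleftrightarrow> E x y"
proof
  assume "x \<in> V" "y \<in> V" "gdist E x y = 1"
  then have "walk E 1 x y" using walk_gdist by metis
  then show "E x y" by simp
next
  assume V: "x \<in> V" "y \<in> V" and "E x y"
  then have "gdist E x y \<le> 1" using gdist_le[of E 1 x y] by simp
  moreover have "gdist E x y \<noteq> 0" using V \<open>E x y\<close> edge_irrefl gdist_eq_0_iff by metis
  ultimately show "gdist E x y = 1" by simp
qed

lemma gdist_edge_le: "x \<in> V \<Longrightarrow> E y z \<Longrightarrow> gdist E x z \<le> gdist E x y + 1"
  using gdist_triangle[of x y z] gdist_eq_1_iff[of y z] edgeD1 edgeD2 by metis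

text \<open>Take the second vertex of a shortest walk from y to x: the rest of the walk bounds its
  distance above, and distances change by at most 1 along an edge.\<close>

lemma gdist_predecessor:
  assumes "x \<in> V" "y \<in> V" "gdist E x y = Suc n"
  shows "\<exists>z\<in>V. E y z \<and> gdist E x z = n"
proof -
  have "walk E (Suc n) y x" using walk_sym[OF walk_gdist[OF assms(1,2)]] unfolding assms(3) .
  then obtain z where z: "E y z" "walk E n z x" by auto
  have "z \<in> V" using edgeD2[OF z(1)] .
  moreover have "gdist E x z \<le> n" using gdist_le[OF walk_sym[OF z(2)]] .
  moreover have "Suc n \<le> gdist E x z + 1"
    using gdist_edge_le[OF assms(1) edge_sym[OF z(1)]] unfolding assms(3) .
  ultimately have "z \<in> V" "gdist E x z = n" by simp_all
  then show ?thesis using z(1) by blast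
qed

definition layer :: "'a \<Rightarrow> nat \<Rightarrow> 'a set" where
  "layer x i = {y\<in>V. gdist E x y = i}"

lemma in_layer: "y \<in> layer x i \<longleftrightarrow> y \<in> V \<and> gdist E x y = i"
  by (simp add: layer_def)

lemma finite_layer [simp]: "finite (layer x i)"
  unfolding layer_def using finV by simp

lemma layer_0: "x \<in> V \<Longrightarrow> layer x 0 = {x}"
  using gdist_eq_0_iff by (auto simp: layer_def)

lemma layer_1: "x \<in> V \<Longrightarrow> layer x 1 = nbrs E x"
  using gdist_eq_1_iff edgeD2 by (auto simp: layer_def)

lemma layer_Suc_subset: "x \<in> V \<Longrightarrow> layer x (Suc i) \<subseteq> (\<Union>z\<in>layer x i. nbrs E z)"
proof
  fix y assume "x \<in> V" "y \<in> layer x (Suc i)"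
  then obtain z where "z \<in> V" "E y z" "gdist E x z = i"
    using gdist_predecessor in_layer by blast
  then have "z \<in> layer x i" "y \<in> nbrs E z"
    using edge_sym by (simp_all add: in_layer)
  then show "y \<in> (\<Union>z\<in>layer x i. nbrs E z)" by blast
qed

end

section \<open>Intersection numbers and sizes of layers\<close>

locale distance_regular_graph =
  fixes V :: "'a set" and E :: "'a \<Rightarrow> 'a \<Rightarrow> bool" and D :: nat and b c :: "nat \<Rightarrow> nat"
  assumes dr: "distance_regular V E D b c"

sublocale distance_regular_graph \<subseteq> simple_connected
  using dr by unfold_locales (auto simp: distance_regular_def)

context distance_regular_graph
begin

lemma finite_distances: "finite {gdist E x y | x y. x \<in> V \<and> y \<in> V}"
proof -
  have "{gdist E x y | x y. x \<in> V \<and> y \<in> V} = (\<lambda>(x, y). gdist E x y) ` (V \<times> V)" by auto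
  then show ?thesis using finV by simp
qed

lemma diameter_eq: "Max {gdist E x y | x y. x \<in> V \<and> y \<in> V} = D"
  using dr unfolding distance_regular_def diameter_def by simp

lemma gdist_le_diameter: "x \<in> V \<Longrightarrow> y \<in> V \<Longrightarrow> gdist E x y \<le> D"
  using Max_ge[OF finite_distances, of "gdist E x y"] unfolding diameter_eq by blast

text \<open>Downward induction from the diameter, which is attained: a predecessor on a geodesic
  realises the next smaller distance.\<close>

lemma ex_gdist_eq: "i \<le> D \<Longrightarrow> \<exists>x\<in>V. \<exists>y\<in>V. gdist E x y = i"
proof (induction rule: inc_induct)
  case base
  have "{gdist E x y | x y. x \<in> V \<and> y \<in> V} \<noteq> {}" using V_nonempty by blast
  then show ?case using Max_in[OF finite_distances] unfolding diameter_eq by blast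
next
  case (step i)
  then show ?case using gdist_predecessor by blast
qed

lemma c_eq:
  assumes "x \<in> V" "y \<in> V" "gdist E x y = Suc i"
  shows "c (Suc i) = card {z\<in>V. E y z \<and> gdist E x z = i}"
proof -
  have "Suc i \<le> D" using gdist_le_diameter assms by metis
  then show ?thesis using dr assms unfolding distance_regular_def by fastforce
qed

lemma b_eq:
  assumes "x \<in> V" "y \<in> V" "gdist E x y = i"
  shows "b i = card {z\<in>V. E y z \<and> gdist E x z = Suc i}"
proof -
  have "i \<le> D" using gdist_le_diameter assms by metis
  then show ?thesis using dr assms unfolding distance_regular_def by fastforce
qed

lemma card_nbrs: "x \<in> V \<Longrightarrow> card (nbrs E x) = b 0"
proof -
  assume x: "x \<in> V"
  have "{z\<in>V. E x z \<and> gdist E x z = Suc 0} = nbrs E x"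
    using gdist_eq_1_iff[OF x] edgeD2 by auto
  then show ?thesis using b_eq[OF x x, of 0] by simp
qed

text \<open>The extra 1 is x itself; the other vertices in the difference are at distance 2 from
  x.\<close>

lemma card_nbrs_diff:
  assumes "E x y"
  shows "card (nbrs E y - nbrs E x) = b 1 + 1"
proof -
  have V: "x \<in> V" "y \<in> V" and d: "gdist E x y = 1"
    using assms edgeD1 edgeD2 gdist_eq_1_iff by auto
  have "nbrs E y - nbrs E x = insert x {z\<in>V. E y z \<and> gdist E x z = Suc 1}" (is "_ = insert x ?S")
  proof (rule set_eqI)
    fix z
    have "gdist E x z \<le> 2" "z \<in> V" if "E y z"
      using gdist_edge_le[OF V(1) that] d that edgeD2 by auto
    moreover have "gdist E x z = 0 \<longleftrightarrow> x = z" "gdist E x z = 1 \<longleftrightarrow> E x z" if "z \<in> V"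
      using V that gdist_eq_0_iff gdist_eq_1_iff by auto
    moreover have "E y x" "\<not> E x x" using assms edge_sym edge_irrefl by auto
    ultimately show "z \<in> nbrs E y - nbrs E x \<longleftrightarrow> z \<in> insert x ?S"
      by (cases "E y z"; cases "gdist E x z = 0"; cases "gdist E x z = 1") auto
  qed
  moreover have "x \<notin> ?S" by simp
  moreover have "finite ?S" using finV by simp
  ultimately show ?thesis using b_eq[OF V d] by simp
qed

text \<open>This is a_1 = k - b_1 - 1, in additive form to avoid truncated subtraction.\<close>

lemma card_nbrs_Int:
  assumes "E x y"
  shows "card (nbrs E y \<inter> nbrs E x) + b 1 + 1 = b 0"
proof -
  have "card (nbrs E y \<inter> nbrs E x) + card (nbrs E y - nbrs E x) = card (nbrs E y)"
    by (simp add: card_Int_Diff[symmetric])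
  then show ?thesis using card_nbrs_diff[OF assms] card_nbrs assms edgeD2 by simp
qed

lemma c_1: "1 \<le> D \<Longrightarrow> c 1 = 1"
proof -
  assume "1 \<le> D"
  then obtain x y where xy: "x \<in> V" "y \<in> V" "gdist E x y = 1" using ex_gdist_eq by blast
  have "E y x" using xy gdist_eq_1_iff edge_sym by blast
  then have "{z\<in>V. E y z \<and> gdist E x z = 0} = {x}" using xy gdist_eq_0_iff by auto
  then show ?thesis using c_eq[OF xy(1,2), of 0] xy by simp
qed

lemma b_1_less_b_0: "1 \<le> D \<Longrightarrow> b 1 < b 0"
proof -
  assume "1 \<le> D"
  then obtain x y where "x \<in> V" "y \<in> V" "gdist E x y = 1" using ex_gdist_eq by blast
  then have "E x y" using gdist_eq_1_iff by blast
  then show ?thesis using card_nbrs_Int by fastforce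
qed

text \<open>Let x' be a neighbour of x one step closer to y. By the triangle inequality, neighbours
  of y at distance i - 1 from x' are at distance exactly i from x.\<close>

lemma c_le_c_Suc:
  assumes "1 \<le> i" "Suc i \<le> D"
  shows "c i \<le> c (Suc i)"
proof -
  obtain j where i: "i = Suc j" using assms by (cases i) auto
  obtain x y where xy: "x \<in> V" "y \<in> V" "gdist E x y = Suc i" using ex_gdist_eq assms by blast
  obtain x' where x': "x' \<in> V" "E x x'" "gdist E y x' = i"
    using gdist_predecessor[of y x i] xy gdist_commute by metis
  have "{z\<in>V. E y z \<and> gdist E x' z = j} \<subseteq> {z\<in>V. E y z \<and> gdist E x z = i}"
  proof safe
    fix z assume z: "z \<in> V" "E y z" "j = gdist E x' z"
    have "gdist E z x \<le> gdist E z x' + 1" using gdist_edge_le z x' edge_sym by blast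
    moreover have "gdist E x y \<le> gdist E x z + 1" using gdist_edge_le xy z edge_sym by blast
    moreover have "gdist E z x = gdist E x z" "gdist E z x' = gdist E x' z"
      using gdist_commute z xy x' by blast+
    ultimately show "gdist E x z = i" using z(3) i xy(3) by linarith
  qed
  then have "card {z\<in>V. E y z \<and> gdist E x' z = j} \<le> card {z\<in>V. E y z \<and> gdist E x z = i}"
    using finV by (intro card_mono) auto
  moreover have "gdist E x' y = Suc j" using gdist_commute[OF x'(1) xy(2)] x'(3) i by simp
  ultimately show ?thesis
    using c_eq[OF xy] c_eq[OF x'(1) xy(2)] i by simp
qed

lemma c_2_le: "2 \<le> i \<Longrightarrow> i \<le> D \<Longrightarrow> c 2 \<le> c i"
proof (induction rule: dec_induct)
  case (step i)
  then show ?case using c_le_c_Suc[of i] by simp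
qed simp

lemma card_layer_Suc_le:
  assumes "x \<in> V"
  shows "card (layer x (Suc i)) \<le> card (layer x i) * b 0"
proof -
  have "card (layer x (Suc i)) \<le> card (\<Union>z\<in>layer x i. nbrs E z)"
    using layer_Suc_subset[OF assms] by (intro card_mono) auto
  also have "\<dots> \<le> (\<Sum>z\<in>layer x i. card (nbrs E z))" by (rule card_UN_le) simp
  also have "\<dots> = card (layer x i) * b 0" using card_nbrs by (simp add: in_layer)
  finally show ?thesis .
qed

text \<open>Double counting of the edges between consecutive layers: an outer vertex sends at least
  c_2 of them inwards, an inner one at most k outwards.\<close>

lemma card_layer_Suc_c_2_le:
  assumes x: "x \<in> V" and i: "1 \<le> i" "Suc i \<le> D"
  shows "card (layer x (Suc i)) * c 2 \<le> card (layer x i) * b 0"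
proof -
  have "card (layer x (Suc i)) * c 2 \<le> card (layer x (Suc i)) * c (Suc i)"
    using c_2_le i by simp
  also have "\<dots> = (\<Sum>y\<in>layer x (Suc i). card {z\<in>layer x i. E z y})"
  proof -
    have "card {z\<in>layer x i. E z y} = c (Suc i)" if "y \<in> layer x (Suc i)" for y
      using c_eq[OF x, of y i] that unfolding layer_def
      by (auto intro!: arg_cong[of _ _ card] dest: edge_sym)
    then show ?thesis by simp
  qed
  also have "\<dots> = (\<Sum>z\<in>layer x i. card {y\<in>layer x (Suc i). E z y})"
    by (rule sum_multicount_gen[symmetric]) auto
  also have "\<dots> \<le> (\<Sum>z\<in>layer x i. b 0)"
  proof (rule sum_mono)
    fix z assume "z \<in> layer x i"
    then have "z \<in> V" by (simp add: in_layer)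
    have "card {y\<in>layer x (Suc i). E z y} \<le> card (nbrs E z)" by (rule card_mono) auto
    then show "card {y\<in>layer x (Suc i). E z y} \<le> b 0" using card_nbrs \<open>z \<in> V\<close> by simp
  qed
  finally show ?thesis by simp
qed

lemma card_V_eq:
  assumes x: "x \<in> V"
  shows "card V = (\<Sum>i\<le>D. card (layer x i))"
proof -
  have "V = (\<Union>i\<le>D. layer x i)" using gdist_le_diameter[OF x] by (auto simp: in_layer)
  also have "card \<dots> = (\<Sum>i\<le>D. card (layer x i))"
    by (rule card_UN_disjoint) (auto simp: in_layer)
  finally show ?thesis .
qed

text \<open>Endpoints of a geodesic of length 3 have disjoint neighbourhoods, and each of its three
edges accounts for at most \<open>b 1 + 1\<close> of the neighbours of the first endpoint.\<close>

lemma b_0_le_3_b_1: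
  assumes "3 \<le> D"
  shows "b 0 \<le> 3 * (b 1 + 1)"
proof -
  obtain x w where xw: "x \<in> V" "w \<in> V" "gdist E x w = Suc (Suc 1)"
    using ex_gdist_eq[OF assms] by (auto simp: numeral_3_eq_3)
  obtain z where z: "z \<in> V" "E w z" "gdist E x z = Suc 1" using gdist_predecessor[OF xw] by blast
  obtain y where y: "y \<in> V" "E z y" "gdist E x y = 1"
    using gdist_predecessor[OF xw(1) z(1,3)] by blast
  have "E y x" using y xw gdist_eq_1_iff edge_sym by blast
  have "u \<notin> nbrs E w" if "E x u" for u
  proof
    assume "u \<in> nbrs E w"
    then have "E u w" using edge_sym by simp
    then have "gdist E x w \<le> gdist E x u + 1" using gdist_edge_le xw by blast
    moreover have "gdist E x u = 1" using that xw gdist_eq_1_iff edgeD2 by blast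
    ultimately show False using xw by simp
  qed
  then have "nbrs E x \<subseteq> (nbrs E x - nbrs E y) \<union> ((nbrs E y - nbrs E z) \<union> (nbrs E z - nbrs E w))"
    by auto
  then have "card (nbrs E x) \<le> card ((nbrs E x - nbrs E y) \<union> ((nbrs E y - nbrs E z) \<union> (nbrs E z - nbrs E w)))"
    by (intro card_mono) auto
  also have "\<dots> \<le> card (nbrs E x - nbrs E y) + (card (nbrs E y - nbrs E z) + card (nbrs E z - nbrs E w))"
    by (rule order.trans[OF card_Un_le add_left_mono[OF card_Un_le]])
  also have "\<dots> = 3 * (b 1 + 1)"
    using card_nbrs_diff \<open>E y x\<close> y z by simp
  finally show ?thesis using card_nbrs xw by simp
qed

end

subsection \<open>Graphs with bounded least eigenvalue\<close>

text \<open>Positive semidefiniteness of A - l I, the form in which the eigenvalue hypothesis is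
  applied to test vectors.\<close>

definition least_eigenvalue_ge :: "'a set \<Rightarrow> ('a \<Rightarrow> 'a \<Rightarrow> bool) \<Rightarrow> real \<Rightarrow> bool" where
  "least_eigenvalue_ge V E l \<longleftrightarrow>
    (\<forall>f. l * (\<Sum>x\<in>V. (f x)\<^sup>2) \<le> (\<Sum>x\<in>V. f x * (\<Sum>y\<in>V. of_bool (E x y) * f y)))"

context simple_connected
begin

lemma least_eigenvalue_geI:
  assumes "\<And>\<mu>. adj_eigenvalue V E \<mu> \<Longrightarrow> l \<le> \<mu>"
  shows "least_eigenvalue_ge V E l"
  unfolding least_eigenvalue_ge_def
proof (intro allI quadratic_form_ge_least_eigenvalue[OF finV])
  fix x y show "of_bool (E x y) = (of_bool (E y x) :: real)" using edge_commute[of x y] by simp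
next
  fix \<mu> and f :: "'a \<Rightarrow> real"
  assume f: "\<exists>x\<in>V. f x \<noteq> 0" "\<forall>x\<in>V. (\<Sum>y\<in>V. of_bool (E x y) * f y) = \<mu> * f x"
  have "(\<Sum>y\<in>V. of_bool (E x y) * f y) = (\<Sum>y\<in>{y \<in> V. E x y}. f y)" for x
    by (rule sum.mono_neutral_cong_right) (use finV in auto)
  then have "adj_eigenvalue V E \<mu>" using f unfolding adj_eigenvalue_def by auto
  then show "l \<le> \<mu>" by (rule assms)
qed

text \<open>Positivity of the Schur complement of the diagonal entry \<open>m\<close> at \<open>x\<close> in \<open>A + m I\<close>.\<close>

lemma sum_over_nbrs_squared_le:
  fixes f :: "'a \<Rightarrow> real"
  assumes psd: "least_eigenvalue_ge V E (- m)" and m: "0 < m"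
    and x: "x \<in> V" and T: "T \<subseteq> V" "x \<notin> T"
  shows "(\<Sum>y\<in>T. of_bool (E x y) * f y)\<^sup>2
    \<le> m * (m * (\<Sum>y\<in>T. (f y)\<^sup>2) + (\<Sum>y\<in>T. f y * (\<Sum>z\<in>T. of_bool (E y z) * f z)))"
proof -
  have finT: "finite T" using T finV finite_subset by blast
  define s where "s = (\<Sum>y\<in>T. of_bool (E x y) * f y)"
  define R where "R = (\<Sum>y\<in>T. f y * (\<Sum>z\<in>T. of_bool (E y z) * f z))"
  \<comment> \<open>The value at x is the optimal one: with \<open>m * f\<close> on T, the form A +
    m I depends on the value u at x as m u^2 + 2 m s u plus a constant, minimal at u = -s.\<close>
  define h where "h z = (if z = x then - s else if z \<in> T then m * f z else 0)" for z
  have hx: "h x = - s" and hT: "\<And>z. z \<in> T \<Longrightarrow> h z = m * f z" and h0: "\<And>z. z \<notin> insert x T \<Longrightarrow> h z = 0"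
    using T by (auto simp: h_def)
  have red: "(\<Sum>z\<in>V. g z) = g x + (\<Sum>z\<in>T. g z)" if "\<And>z. z \<notin> insert x T \<Longrightarrow> g z = 0" for g :: "'a \<Rightarrow> real"
  proof -
    have "(\<Sum>z\<in>V. g z) = (\<Sum>z\<in>insert x T. g z)"
      by (rule sum.mono_neutral_right) (use finV x T that in auto)
    then show ?thesis using T finT by simp
  qed
  have "(\<Sum>z\<in>V. (h z)\<^sup>2) = (h x)\<^sup>2 + (\<Sum>z\<in>T. (h z)\<^sup>2)" by (rule red) (simp add: h0)
  also have "\<dots> = s\<^sup>2 + m\<^sup>2 * (\<Sum>z\<in>T. (f z)\<^sup>2)"
    by (simp add: hx hT power_mult_distrib sum_distrib_left)
  finally have n: "(\<Sum>z\<in>V. (h z)\<^sup>2) = s\<^sup>2 + m\<^sup>2 * (\<Sum>z\<in>T. (f z)\<^sup>2)" .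
  have inner: "(\<Sum>z\<in>V. of_bool (E y z) * h z)
      = of_bool (E y x) * (- s) + m * (\<Sum>z\<in>T. of_bool (E y z) * f z)" for y
  proof -
    have "(\<Sum>z\<in>V. of_bool (E y z) * h z) = of_bool (E y x) * h x + (\<Sum>z\<in>T. of_bool (E y z) * h z)"
      by (rule red) (simp add: h0)
    also have "(\<Sum>z\<in>T. of_bool (E y z) * h z) = m * (\<Sum>z\<in>T. of_bool (E y z) * f z)"
      by (simp add: hT sum_distrib_left mult.left_commute)
    finally show ?thesis by (simp add: hx)
  qed
  have "(\<Sum>y\<in>V. h y * (\<Sum>z\<in>V. of_bool (E y z) * h z))
      = h x * (\<Sum>z\<in>V. of_bool (E x z) * h z) + (\<Sum>y\<in>T. h y * (\<Sum>z\<in>V. of_bool (E y z) * h z))"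
    by (rule red) (simp add: h0)
  also have "h x * (\<Sum>z\<in>V. of_bool (E x z) * h z) = - (m * s\<^sup>2)"
    unfolding inner hx s_def[symmetric] using edge_irrefl by (simp add: power2_eq_square)
  also have "(\<Sum>y\<in>T. h y * (\<Sum>z\<in>V. of_bool (E y z) * h z))
      = (\<Sum>y\<in>T. - (m * s) * (of_bool (E x y) * f y) + m\<^sup>2 * (f y * (\<Sum>z\<in>T. of_bool (E y z) * f z)))"
    unfolding inner by (intro sum.cong refl) (simp add: hT edge_commute[of x] algebra_simps power2_eq_square)
  also have "\<dots> = - (m * s\<^sup>2) + m\<^sup>2 * R"
    unfolding sum.distrib sum_distrib_left[symmetric] s_def[symmetric] R_def[symmetric]
    by (simp add: power2_eq_square)
  finally have "- m * (s\<^sup>2 + m\<^sup>2 * (\<Sum>z\<in>T. (f z)\<^sup>2)) \<le> - (m * s\<^sup>2) + (- (m * s\<^sup>2) + m\<^sup>2 * R)"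
    using psd[unfolded least_eigenvalue_ge_def, rule_format, of h] unfolding n by simp
  then have "m * s\<^sup>2 \<le> m * (m * (m * (\<Sum>z\<in>T. (f z)\<^sup>2) + R))"
    by (simp add: algebra_simps power2_eq_square)
  then have "s\<^sup>2 \<le> m * (m * (\<Sum>z\<in>T. (f z)\<^sup>2) + R)" using m by simp
  then show ?thesis unfolding s_def R_def .
qed

text \<open>The test vector is 1 on I: by independence its adjacency terms vanish, leaving |I|^2
  \<le> m^2 |I|.\<close>

lemma card_independent_nbrs_le:
  assumes psd: "least_eigenvalue_ge V E (- m)" and m: "0 < m"
    and I: "I \<subseteq> nbrs E x" "\<And>y z. y \<in> I \<Longrightarrow> z \<in> I \<Longrightarrow> \<not> E y z"
  shows "real (card I) \<le> m\<^sup>2"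
proof (cases "I = {}")
  case False
  then have x: "x \<in> V" using I edgeD1 by auto
  have finI: "finite I" using finite_subset[OF I(1) finite_nbrs] .
  have "x \<notin> I" "I \<subseteq> V" using I(1) edge_irrefl nbrs_subset by auto
  from sum_over_nbrs_squared_le[OF psd m x this(2,1), of "\<lambda>_. 1"]
  have "(\<Sum>y\<in>I. of_bool (E x y))\<^sup>2 \<le> m * (m * real (card I) + (\<Sum>y\<in>I. \<Sum>z\<in>I. of_bool (E y z)))"
    by simp
  moreover have "(\<Sum>y\<in>I. of_bool (E x y)) = real (card I)"
    using I(1) by (simp add: subset_eq)
  moreover have "(\<Sum>y\<in>I. \<Sum>z\<in>I. of_bool (E y z)) = (0::real)" using I(2) by simp
  ultimately have "real (card I) * real (card I) \<le> m\<^sup>2 * real (card I)"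
    by (simp add: power2_eq_square algebra_simps)
  then show ?thesis using False finI by (simp add: card_gt_0_iff)
qed simp

text \<open>A vertex sees either few or nearly all vertices of a clique: the test vector is constant on
the neighbours and on the non-neighbours of \<open>x\<close> in \<open>K\<close>, and sums to 0 over \<open>K\<close>.\<close>

lemma card_clique_nbrs_mult_non_nbrs_le:
  assumes psd: "least_eigenvalue_ge V E (- m)" and m: "2 \<le> m"
    and K: "K \<subseteq> V" "\<And>y z. y \<in> K \<Longrightarrow> z \<in> K \<Longrightarrow> y \<noteq> z \<Longrightarrow> E y z" and x: "x \<in> V"
  shows "real (card {y\<in>K. E x y}) * real (card {y\<in>K. \<not> E x y}) \<le> m * (m - 1) * real (card K)"
proof -
  define p where "p = real (card {y\<in>K. E x y})"
  define q where "q = real (card {y\<in>K. \<not> E x y})"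
  have finK: "finite K" using K finV finite_subset by blast
  have pq: "p + q = real (card K)"
    unfolding p_def q_def of_nat_add[symmetric] using finK
    by (subst card_Un_disjoint[symmetric]) (auto intro!: arg_cong[of _ _ card])
  have nn: "p \<ge> 0" "q \<ge> 0" by (auto simp: p_def q_def)
  have m1: "1 \<le> m * (m - 1)" using mult_mono[of 1 m 1 "m - 1"] m by simp
  \<comment> \<open>The Schur complement needs x outside K. For x in K the only non-neighbour is x
    itself, and m (m - 1) \<ge> 1 suffices.\<close>
  show ?thesis
  proof (cases "x \<in> K")
    case True
    then have "{y\<in>K. \<not> E x y} = {x}" using K edge_irrefl by auto
    then have "p * q \<le> real (card K)" using pq nn by (simp add: q_def)
    also have "\<dots> \<le> m * (m - 1) * real (card K)" using m1 mult_right_mono[OF m1, of "real (card K)"] by simp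
    finally show ?thesis by (simp add: p_def q_def)
  next
    case False
    define f where "f y = (if E x y then q else - p)" for y
    have split: "(\<Sum>y\<in>K. if E x y then u else v) = p * u + q * v" for u v :: real
    proof -
      have "K \<inter> {y. E x y} = {y\<in>K. E x y}" "K \<inter> - {y. E x y} = {y\<in>K. \<not> E x y}" by auto
      then show ?thesis unfolding sum.If_cases[OF finK] by (simp add: p_def q_def)
    qed
    have f0: "(\<Sum>y\<in>K. f y) = 0" unfolding f_def split by simp
    have f2: "(\<Sum>y\<in>K. (f y)\<^sup>2) = p * q * (p + q)"
    proof -
      have "(\<Sum>y\<in>K. (f y)\<^sup>2) = (\<Sum>y\<in>K. if E x y then q\<^sup>2 else p\<^sup>2)"
        by (intro sum.cong) (auto simp: f_def)
      then show ?thesis unfolding split by (simp add: power2_eq_square algebra_simps)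
    qed
    have fs: "(\<Sum>y\<in>K. of_bool (E x y) * f y) = p * q"
    proof -
      have "(\<Sum>y\<in>K. of_bool (E x y) * f y) = (\<Sum>y\<in>K. if E x y then q else 0)"
        by (intro sum.cong) (auto simp: f_def)
      then show ?thesis unfolding split by simp
    qed
    have ff: "(\<Sum>y\<in>K. f y * (\<Sum>z\<in>K. of_bool (E y z) * f z)) = - (p * q * (p + q))"
    proof -
      \<comment> \<open>On a clique, adjacency is the all-ones matrix minus the identity; as f sums
        to 0, it is an eigenvector for -1.\<close>
      have "(\<Sum>z\<in>K. of_bool (E y z) * f z) = - f y" if y: "y \<in> K" for y
      proof -
        have "(\<Sum>z\<in>K. of_bool (E y z) * f z) = (\<Sum>z\<in>K - {y}. f z)"
          by (rule sum.mono_neutral_cong_right) (use finK K y edge_irrefl in auto)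
        also have "\<dots> = (\<Sum>z\<in>K. f z) - f y" using y finK by (simp add: sum_diff1)
        finally show ?thesis using f0 by simp
      qed
      then have "(\<Sum>y\<in>K. f y * (\<Sum>z\<in>K. of_bool (E y z) * f z)) = (\<Sum>y\<in>K. - (f y)\<^sup>2)"
        by (intro sum.cong) (auto simp: power2_eq_square)
      then show ?thesis using f2 by (simp add: sum_negf)
    qed
    have "(p * q)\<^sup>2 \<le> m * (m * (p * q * (p + q)) + - (p * q * (p + q)))"
      using sum_over_nbrs_squared_le[OF psd _ x K(1) False, of f] m unfolding fs f2 ff by simp
    then have *: "(p * q) * (p * q) \<le> (p * q) * (m * (m - 1) * (p + q))"
      by (simp add: power2_eq_square algebra_simps)
    have "p * q \<le> m * (m - 1) * (p + q)"
    proof (cases "p * q = 0")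
      case True
      then show ?thesis unfolding True using m nn by (intro mult_nonneg_nonneg add_nonneg_nonneg) auto
    next
      case False
      then have "0 < p * q" using nn by (metis mult_nonneg_nonneg order_le_less)
      with * show ?thesis by (simp only: mult_le_cancel_left_pos)
    qed
    then show ?thesis using pq by (simp add: p_def q_def)
  qed
qed

end

subsection \<open>Bounding the valency\<close>

context distance_regular_graph
begin

text \<open>A maximal independent set of neighbours of a vertex dominates its neighbourhood.\<close>

lemma b_0_le_of_least_eigenvalue_ge:
  assumes D: "1 \<le> D" and psd: "least_eigenvalue_ge V E (- m)" and m: "0 < m"
  shows "real (b 0) \<le> m\<^sup>2 * (real (b 0) - real (b 1))"
proof -
  obtain x where x: "x \<in> V" using V_nonempty by blast
  define \<I> where "\<I> = {I. I \<subseteq> nbrs E x \<and> (\<forall>y\<in>I. \<forall>z\<in>I. \<not> E y z)}"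
  have "\<I> \<subseteq> Pow (nbrs E x)" "{} \<in> \<I>" by (auto simp: \<I>_def)
  then have "finite \<I>" "\<I> \<noteq> {}" using finite_subset by (metis finite_Pow_iff finite_nbrs, blast)
  then obtain I where I: "I \<in> \<I>" and max: "\<And>J. J \<in> \<I> \<Longrightarrow> I \<subseteq> J \<Longrightarrow> I = J"
    using finite_has_maximal by metis
  have Isub: "I \<subseteq> nbrs E x" and indep: "\<And>y z. y \<in> I \<Longrightarrow> z \<in> I \<Longrightarrow> \<not> E y z"
    using I by (auto simp: \<I>_def)
  have finI: "finite I" using finite_subset[OF Isub finite_nbrs] .
  have "nbrs E x \<subseteq> (\<Union>y\<in>I. insert y (nbrs E y \<inter> nbrs E x))"
  proof
    fix z assume z: "z \<in> nbrs E x"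
    show "z \<in> (\<Union>y\<in>I. insert y (nbrs E y \<inter> nbrs E x))"
    proof (rule ccontr)
      assume not: "z \<notin> (\<Union>y\<in>I. insert y (nbrs E y \<inter> nbrs E x))"
      then have "\<not> E y z" "\<not> E z y" if "y \<in> I" for y
        using z that edge_commute[of y z] by auto
      then have "insert z I \<in> \<I>"
        using Isub z indep edge_irrefl by (auto simp: \<I>_def)
      then have "z \<in> I" using max by blast
      then show False using not by blast
    qed
  qed
  then have "card (nbrs E x) \<le> card (\<Union>y\<in>I. insert y (nbrs E y \<inter> nbrs E x))"
    using finI by (intro card_mono) auto
  also have "\<dots> \<le> (\<Sum>y\<in>I. card (insert y (nbrs E y \<inter> nbrs E x)))"
    by (rule card_UN_le[OF finI])
  \<comment> \<open>Each y dominates itself and its a_1 common neighbours with x, and a_1 + 1 = b_0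
    - b_1.\<close>
  also have "real \<dots> = (\<Sum>y\<in>I. real (b 0) - real (b 1))"
    unfolding of_nat_sum
  proof (rule sum.cong)
    fix y assume "y \<in> I"
    then have "E x y" using Isub by auto
    then show "real (card (insert y (nbrs E y \<inter> nbrs E x))) = real (b 0) - real (b 1)"
      using card_nbrs_Int[of x y] edge_irrefl by simp
  qed simp
  finally have "real (b 0) \<le> real (card I) * (real (b 0) - real (b 1))"
    using card_nbrs[OF x] by simp
  also have "\<dots> \<le> m\<^sup>2 * (real (b 0) - real (b 1))"
    using card_independent_nbrs_le[OF psd m Isub indep] b_1_less_b_0[OF D]
    by (intro mult_right_mono) auto
  finally show ?thesis .
qed

text \<open>Double counting of the triples \<open>(w, y, z)\<close> with \<open>y, z\<close> in the clique \<open>K\<close>, where \<open>w\<close> is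
adjacent to \<open>y\<close> but not to \<open>z\<close>.\<close>

lemma card_clique_le:
  assumes psd: "least_eigenvalue_ge V E (- m)" and m: "2 \<le> m"
    and K: "K \<subseteq> V" "\<And>y z. y \<in> K \<Longrightarrow> z \<in> K \<Longrightarrow> y \<noteq> z \<Longrightarrow> E y z" "K \<noteq> {}"
  shows "(real (card K) - 1) * (real (b 1) + 1) \<le> m * (m - 1) * real (card V)"
proof -
  have finK: "finite K" using K finV finite_subset by blast
  define s where "s = real (card K)"
  have s: "s > 0" unfolding s_def using K finK by (simp add: card_gt_0_iff)
  have "(\<Sum>w\<in>V. card {p\<in>K \<times> K. E w (fst p) \<and> \<not> E w (snd p)})
      = (\<Sum>p\<in>K \<times> K. card {w\<in>V. E w (fst p) \<and> \<not> E w (snd p)})"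
    using finV finK by (intro sum_multicount_gen) auto
  also have "\<dots> = (\<Sum>y\<in>K. \<Sum>z\<in>K. card (nbrs E y - nbrs E z))"
  proof -
    have "{w\<in>V. E w y \<and> \<not> E w z} = nbrs E y - nbrs E z" for y z
      using edge_commute edgeD1 by auto
    then show ?thesis by (simp add: sum.cartesian_product case_prod_beta)
  qed
  \<comment> \<open>Diagonal pairs contribute nothing; every other pair is an edge.\<close>
  also have "\<dots> = (\<Sum>y\<in>K. \<Sum>z\<in>K - {y}. b 1 + 1)"
  proof (rule sum.cong)
    fix y assume y: "y \<in> K"
    have "(\<Sum>z\<in>K. card (nbrs E y - nbrs E z)) = (\<Sum>z\<in>K - {y}. card (nbrs E y - nbrs E z))"
      using finK y by (simp add: sum.remove)
    also have "\<dots> = (\<Sum>z\<in>K - {y}. b 1 + 1)"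
      using K y by (intro sum.cong card_nbrs_diff) auto
    finally show "(\<Sum>z\<in>K. card (nbrs E y - nbrs E z)) = (\<Sum>z\<in>K - {y}. b 1 + 1)" .
  qed simp
  also have "\<dots> = card K * ((card K - 1) * (b 1 + 1))"
    using finK by simp
  finally have "real (\<Sum>w\<in>V. card {p\<in>K \<times> K. E w (fst p) \<and> \<not> E w (snd p)})
      = real (card K * ((card K - 1) * (b 1 + 1)))" by (rule arg_cong)
  also have "\<dots> = s * ((s - 1) * (real (b 1) + 1))"
    using s unfolding s_def by (cases "card K") (simp_all add: algebra_simps)
  finally have 1: "real (\<Sum>w\<in>V. card {p\<in>K \<times> K. E w (fst p) \<and> \<not> E w (snd p)})
      = s * ((s - 1) * (real (b 1) + 1))" .
  have "real (\<Sum>w\<in>V. card {p\<in>K \<times> K. E w (fst p) \<and> \<not> E w (snd p)})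
      = (\<Sum>w\<in>V. real (card {y\<in>K. E w y}) * real (card {y\<in>K. \<not> E w y}))"
    unfolding of_nat_sum
  proof (rule sum.cong)
    fix w
    have "{p\<in>K \<times> K. E w (fst p) \<and> \<not> E w (snd p)} = {y\<in>K. E w y} \<times> {y\<in>K. \<not> E w y}" by auto
    then show "real (card {p\<in>K \<times> K. E w (fst p) \<and> \<not> E w (snd p)})
        = real (card {y\<in>K. E w y}) * real (card {y\<in>K. \<not> E w y})"
      by (simp add: card_cartesian_product)
  qed simp
  \<comment> \<open>For each single w the few-or-nearly-all bound for cliques applies; a factor s
    then cancels.\<close>
  also have "\<dots> \<le> (\<Sum>w\<in>V. m * (m - 1) * s)"
    unfolding s_def by (intro sum_mono card_clique_nbrs_mult_non_nbrs_le[OF psd m K(1,2)])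
  also have "\<dots> = s * (m * (m - 1) * real (card V))" by simp
  finally show ?thesis using s unfolding 1 s_def[symmetric] by simp
qed

text \<open>R bounds k / c_2, so from layer 1 on the layers grow at most geometrically with ratio R.
  The bound is linear in k, which lets k cancel against the clique estimate.\<close>

lemma card_V_le:
  assumes k: "1 \<le> b 0" and D: "1 \<le> D" and R: "1 \<le> R" and c2: "real (b 0) \<le> R * real (c 2)"
  shows "real (card V) \<le> real (D + 1) * real (b 0) * R ^ D"
proof -
  obtain x where x: "x \<in> V" using V_nonempty by blast
  have c2pos: "0 < real (c 2)" using c2 R k by (cases "c 2 = 0") auto
  have step: "real (card (layer x (Suc i))) \<le> real (b 0) * R ^ Suc i" if "Suc i \<le> D" for i
    using that
  proof (induction i)
    case 0
    have "real (b 0) * 1 \<le> real (b 0) * R" using R by (intro mult_left_mono) auto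
    then show ?case using layer_1[OF x] card_nbrs[OF x] by simp
  next
    case (Suc i)
    have "real (card (layer x (Suc (Suc i)))) * real (c 2) \<le> real (card (layer x (Suc i))) * real (b 0)"
      using card_layer_Suc_c_2_le[OF x, of "Suc i"] Suc.prems
      unfolding of_nat_mult[symmetric] of_nat_le_iff by simp
    also have "\<dots> \<le> (real (b 0) * R ^ Suc i) * (R * real (c 2))"
      using Suc c2 R by (intro mult_mono) auto
    also have "\<dots> = (real (b 0) * R ^ Suc (Suc i)) * real (c 2)" by simp
    finally show ?case using c2pos by (simp only: mult_le_cancel_right_pos)
  qed
  have "real (card (layer x i)) \<le> real (b 0) * R ^ D" if i: "i \<le> D" for i
  proof -
    have "real (card (layer x i)) \<le> real (b 0) * R ^ i"
      using layer_0[OF x] k step i by (cases i) auto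
    also have "\<dots> \<le> real (b 0) * R ^ D" using i R by (intro mult_left_mono power_increasing) auto
    finally show ?thesis .
  qed
  then have "(\<Sum>i\<le>D. real (card (layer x i))) \<le> (\<Sum>i\<le>D. real (b 0) * R ^ D)"
    by (intro sum_mono) simp
  then show ?thesis using card_V_eq[OF x] by (simp add: mult.assoc)
qed

text \<open>A crude bound that ignores c_2, sufficient once the valency is bounded. The base
  \<open>b 0 + 1\<close> is at least 1, so its powers are monotone.\<close>

lemma card_V_le_power: "card V \<le> (D + 1) * (b 0 + 1) ^ D"
proof -
  obtain x where x: "x \<in> V" using V_nonempty by blast
  have "card (layer x i) \<le> (b 0 + 1) ^ i" for i
  proof (induction i)
    case 0
    then show ?case using layer_0[OF x] by simp
  next
    case (Suc i)
    have "card (layer x (Suc i)) \<le> card (layer x i) * b 0" by (rule card_layer_Suc_le[OF x])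
    also have "\<dots> \<le> (b 0 + 1) ^ i * (b 0 + 1)" using Suc by (intro mult_mono) auto
    finally show ?case by (simp add: mult.commute)
  qed
  then have "card (layer x i) \<le> (b 0 + 1) ^ D" if "i \<le> D" for i
    using that power_increasing[of i D "b 0 + 1"] order.trans by fastforce
  then have "(\<Sum>i\<le>D. card (layer x i)) \<le> (\<Sum>i\<le>D. (b 0 + 1) ^ D)" by (intro sum_mono) simp
  then show ?thesis using card_V_eq[OF x] by simp
qed

end

section \<open>The uniform valency bound via Ramsey's theorem\<close>

lemma ex_valency_bound:
  fixes \<epsilon> m :: real
  assumes \<epsilon>: "0 < \<epsilon>" "\<epsilon> < 1" and m: "2 \<le> m" and D: "3 \<le> D"
  shows "\<exists>k. \<forall>(V :: 'a set) E b c. distance_regular V E D b c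
    \<and> least_eigenvalue_ge V E (- m)
    \<and> real (c 2) \<ge> \<epsilon> * (real (b 0) - real (b 1) - real (c 1)) \<longrightarrow> b 0 < k"
proof -
  \<comment> \<open>R will bound k / c_2. The sizes s and t lie just beyond what is possible in a
    neighbourhood: cliques satisfy s - 1 \<le> B and independent sets have at most m^2
    vertices.\<close>
  define R where "R = 2 * m\<^sup>2 / \<epsilon>"
  define B where "B = 3 * (m * (m - 1)) * (real (D + 1) * R ^ D)"
  define s where "s = nat \<lceil>B\<rceil> + 2"
  define t where "t = nat \<lceil>m\<^sup>2\<rceil> + 1"
  have m2: "4 \<le> m\<^sup>2" using power_mono[of 2 m 2] m by simp
  have R: "1 \<le> R" unfolding R_def using m2 \<epsilon> by (simp add: field_simps)
  obtain r where r: "\<And>(V :: 'a set) F. finite V \<Longrightarrow> r \<le> card V \<Longrightarrow>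
      \<exists>R\<subseteq>V. card R = s \<and> clique R F \<or> card R = t \<and> indep R F"
    using ramsey2[of s t] by metis
  \<comment> \<open>Valency at least r makes Ramsey's theorem applicable; valency at least 2 m^2
    absorbs an additive constant below.\<close>
  define k where "k = Suc (r + nat \<lceil>2 * m\<^sup>2\<rceil>)"
  have "b 0 < k" if dr: "distance_regular V E D b c" and psd: "least_eigenvalue_ge V E (- m)"
    and c2: "real (c 2) \<ge> \<epsilon> * (real (b 0) - real (b 1) - real (c 1))" for V :: "'a set" and E b c
  proof (rule ccontr)
    interpret distance_regular_graph V E D b c using dr by unfold_locales
    assume "\<not> b 0 < k"
    then have kr: "r \<le> b 0" and km: "2 * m\<^sup>2 \<le> real (b 0)" and k1: "1 \<le> b 0"
      unfolding k_def by linarith+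
    have "c 1 = 1" using c_1 D by simp
    have "real (b 0) \<le> R * real (c 2)"
    proof -
      have "real (b 0) \<le> m\<^sup>2 * (real (b 0) - real (b 1))"
        using b_0_le_of_least_eigenvalue_ge[OF _ psd] m D by simp
      \<comment> \<open>The previous bound is m^2 (a_1 + 1); since m^2 is at most half the valency,
        the 1 is absorbed by doubling the constant.\<close>
      then have "real (b 0) \<le> 2 * m\<^sup>2 * (real (b 0) - real (b 1) - real (c 1))"
        using km \<open>c 1 = 1\<close> by (simp add: algebra_simps)
      also have "\<dots> = R * (\<epsilon> * (real (b 0) - real (b 1) - real (c 1)))"
        unfolding R_def using \<epsilon> by simp
      also have "\<dots> \<le> R * real (c 2)" using c2 R by (intro mult_left_mono) auto
      finally show ?thesis .
    qed
    then have v: "real (card V) \<le> real (D + 1) * real (b 0) * R ^ D"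
      using card_V_le[OF k1 _ R] D by simp
    obtain x where x: "x \<in> V" using V_nonempty by blast
    obtain K where K: "K \<subseteq> nbrs E x"
      and alt: "card K = s \<and> clique K {{y, z} | y z. E y z} \<or> card K = t \<and> indep K {{y, z} | y z. E y z}"
      using r[OF finite_nbrs, of x "{{y, z} | y z. E y z}"] card_nbrs[OF x] kr by auto
    have edge: "{y, z} \<in> {{y, z} | y z. E y z} \<longleftrightarrow> E y z" for y z
      using edge_sym by (auto simp: doubleton_eq_iff)
    show False
      using alt
    proof
      assume "card K = t \<and> indep K {{y, z} | y z. E y z}"
      \<comment> \<open>\<open>indep\<close> concerns distinct vertices only; irreflexivity supplies
        the diagonal.\<close>
      then have t: "card K = t" and "\<And>y z. y \<in> K \<Longrightarrow> z \<in> K \<Longrightarrow> \<not> E y z"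
        unfolding indep_def edge using edge_irrefl by metis+
      then have "real (card K) \<le> m\<^sup>2"
        using card_independent_nbrs_le[OF psd _ K] m by simp
      then show False unfolding t t_def by linarith
    next
      assume "card K = s \<and> clique K {{y, z} | y z. E y z}"
      then have s: "card K = s" and clique: "\<And>y z. y \<in> K \<Longrightarrow> z \<in> K \<Longrightarrow> y \<noteq> z \<Longrightarrow> E y z"
        unfolding clique_def edge by blast+
      have "K \<noteq> {}" using s unfolding s_def by auto
      have s1: "0 \<le> real s - 1" unfolding s_def by simp
      \<comment> \<open>Since b_1 + 1 \<ge> k/3 and |V| is at most a constant times k, the valency
        cancels and s - 1 \<le> B contradicts the choice of s.\<close>
      have "(real s - 1) * real (b 0) \<le> (real s - 1) * (3 * (real (b 1) + 1))"
        using s1 b_0_le_3_b_1[OF D] by (intro mult_left_mono) auto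
      also have "\<dots> = 3 * ((real s - 1) * (real (b 1) + 1))" by simp
      also have "\<dots> \<le> 3 * (m * (m - 1) * real (card V))"
        using card_clique_le[OF psd m _ clique \<open>K \<noteq> {}\<close>] K nbrs_subset s by fastforce
      also have "\<dots> \<le> 3 * (m * (m - 1) * (real (D + 1) * real (b 0) * R ^ D))"
        using v m by (intro mult_left_mono) auto
      also have "\<dots> = B * real (b 0)" unfolding B_def by simp
      finally have "real s - 1 \<le> B" using k1 by simp
      then show False unfolding s_def by linarith
    qed
  qed
  then show ?thesis by blast
qed

section \<open>Finiteness up to isomorphism\<close>

lemma finite_graphs_on_initial_segments:
  "finite {(W :: nat set, F). \<exists>n\<le>N. W = {..<n} \<and> (\<forall>x y. F x y \<longrightarrow> x < n \<and> y < n)}" (is "finite ?S")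
proof (rule finite_subset)
  \<comment> \<open>As F is false outside the segment, it is determined by a subset of a fixed
    finite square; unrestricted relations on nat would give infinitely many pairs.\<close>
  show "?S \<subseteq> (\<lambda>(n, A). ({..<n}, \<lambda>x y. (x, y) \<in> A)) ` ({..N} \<times> Pow ({..<N} \<times> {..<N}))"
  proof safe
    fix F :: "nat \<Rightarrow> nat \<Rightarrow> bool" and n
    assume n: "n \<le> N" and F: "\<forall>x y. F x y \<longrightarrow> x < n \<and> y < n"
    have "{(x, y). F x y} \<subseteq> {..<N} \<times> {..<N}" using n F by force
    then show "({..<n}, F) \<in> (\<lambda>(n, A). ({..<n}, \<lambda>x y. (x, y) \<in> A)) ` ({..N} \<times> Pow ({..<N} \<times> {..<N}))"
      using n by (intro image_eqI[of _ _ "(n, {(x, y). F x y})"]) auto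
  qed
qed simp

lemma ex_iso_on_initial_segment:
  assumes "finite V"
  shows "\<exists>F. (\<forall>x y. F x y \<longrightarrow> x < card V \<and> y < card V) \<and> graph_iso V E {..<card V} F"
proof -
  obtain h where h: "bij_betw h V {..<card V}"
    using ex_bij_betw_finite_nat[OF assms] by (auto simp: atLeast0LessThan)
  \<comment> \<open>Transport along h, false off the image so that the pair lies in the finite
    family.\<close>
  define F where "F i j \<longleftrightarrow> (\<exists>x\<in>V. \<exists>y\<in>V. i = h x \<and> j = h y \<and> E x y)" for i j
  have "E x y \<longleftrightarrow> F (h x) (h y)" if "x \<in> V" "y \<in> V" for x y
    using that h unfolding F_def bij_betw_def inj_on_def by blast
  moreover have "x < card V \<and> y < card V" if "F x y" for x y
    using that bij_betwE[OF h] unfolding F_def by auto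
  ultimately show ?thesis unfolding graph_iso_def using h by blast
qed

theorem theorem3p3:
  fixes \<epsilon> :: real and m :: int and D :: nat
  assumes "0 < \<epsilon>" and "\<epsilon> < 1" and "m \<ge> 2" and "D \<ge> 3"
  shows "\<exists>S :: (nat set \<times> (nat \<Rightarrow> nat \<Rightarrow> bool)) set. finite S \<and>
    (\<forall>(V :: 'a set) E b c.
        distance_regular V E D b c \<and>
        (\<forall>\<mu>::real. adj_eigenvalue V E \<mu> \<longrightarrow> \<mu> \<ge> - real_of_int m) \<and>
        real (c 2) \<ge> \<epsilon> * (real (b 0) - real (b 1) - real (c 1))
      \<longrightarrow> (\<exists>(W, F)\<in>S. graph_iso V E W F))"
proof -
  obtain k where k: "\<And>(V :: 'a set) E b c. distance_regular V E D b c
      \<Longrightarrow> least_eigenvalue_ge V E (- real_of_int m)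
      \<Longrightarrow> real (c 2) \<ge> \<epsilon> * (real (b 0) - real (b 1) - real (c 1)) \<Longrightarrow> b 0 < k"
    using ex_valency_bound[OF assms(1,2) _ assms(4), of "real_of_int m"] assms(3)
    by (metis of_int_le_iff of_int_numeral)
  \<comment> \<open>As \<open>k\<close> is independent of the graph, N and S are fixed before any
    graph is given; \<open>b 0 < k\<close> lets \<open>k\<close> replace the base
    \<open>b 0 + 1\<close>.\<close>
  define N where "N = (D + 1) * k ^ D"
  define S where "S = {(W :: nat set, F). \<exists>n\<le>N. W = {..<n} \<and> (\<forall>x y. F x y \<longrightarrow> x < n \<and> y < n)}"
  have iso: "\<exists>(W, F)\<in>S. graph_iso V E W F"
    if dr: "distance_regular V E D b c"
      and eig: "\<forall>\<mu>::real. adj_eigenvalue V E \<mu> \<longrightarrow> \<mu> \<ge> - real_of_int m"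
      and c2: "real (c 2) \<ge> \<epsilon> * (real (b 0) - real (b 1) - real (c 1))" for V :: "'a set" and E b c
  proof -
    interpret distance_regular_graph V E D b c using dr by unfold_locales
    have "b 0 < k" using k[OF dr least_eigenvalue_geI c2] eig by blast
    then have "(D + 1) * (b 0 + 1) ^ D \<le> N"
      unfolding N_def by (intro mult_left_mono power_mono) auto
    then have "card V \<le> N" using card_V_le_power by linarith
    obtain F where "\<forall>x y. F x y \<longrightarrow> x < card V \<and> y < card V" and F: "graph_iso V E {..<card V} F"
      using ex_iso_on_initial_segment[OF finV] by blast
    then have "({..<card V}, F) \<in> S" unfolding S_def using \<open>card V \<le> N\<close> by auto
    then show ?thesis using F by blast
  qed
  have "finite S" unfolding S_def by (rule finite_graphs_on_initial_segments)
  then show ?thesis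
    by (intro exI[of _ S] conjI allI impI; (elim conjE)?) (assumption, rule iso)
qed

end
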